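(* Let $V=\mathbb C[A^{(n)},B^{(n)},C^{(n)}]_{n\in\mathbb Z}$ be the free difference algebra on three generators $A,B,C$. The Poisson brackets of generators $$\{B(\tau_1),C(\tau_2)\}=C(\tau_2)(T_2^{-1}-1)\delta(\tau_1,\tau_2),\qquad \{C(\tau_1),B(\tau_2)\}=(1-T_2)C(\tau_2)\delta(\tau_1,\tau_2),$$ with all other brackets between the generators $A,B,C$ equal to zero, extend to a singular Hamiltonian map $\Gamma$ on $V$. Consequently, the products $f_n g$ defined by $\{f(\tau_1),g(\tau_2)\}=\sum_{n}(f_ng)(\tau_2)T_2^n\delta(\tau_1,\tau_2)$ give $V$ the structure of an $H_T$-vertex Poisson algebra.
   Context: $H_T=\mathbb C[T,T^{-1}]$ is the Hopf algebra with coproduct $T\mapsto T\otimes T$, counit $T\mapsto 1$, antipode $S(T)=T^{-1}$. Put $\Delta=T-1$, $\bar\Delta=1-T^{-1}$, $\Delta[m]=\Delta^m/m!$ for $m\ge0$ and $\Delta[-k]=\bar\Delta^k/k!$ for $k>0$; $\{\Delta[m]\}_{m\in\mathbb Z}$ is a basis of $H_T$. A commutative $H_T$-Leibniz algebra $V$ is a commutative unital $\mathbb C$-algebra which is an $H_T$-module with $T$ acting by an algebra automorphism. The free difference algebra on $A,B,C$ is the polynomial algebra in the variables $Y^{(n)}=\Delta[n]Y$, $Y\in\{A,B,C\}$, $n\in\mathbb Z$ (equivalently, in the variables $T^nY$), with its evident structure of $H_T$-Leibniz algebra. $VH_T$ is the algebra of difference operators: finite sums $P=\sum_n p_nT^n$,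 $p_n\in V$, with $Tp=T\langle p\rangle T$, where $T\langle p\rangle$ denotes the action of $T$ on $p\in V$. The adjoint is $P^*=\sum_n T^{-n}p_n=\sum_nT^{-n}\langle p_n\rangle T^{-n}$. The module $V(\tau_1,\tau_2)$ of two-variable classical fields consists of expressions $Q_2\delta(\tau_1,\tau_2)=\sum_n q_n(\tau_2)T_2^n\delta(\tau_1,\tau_2)$ with unique $Q=\sum q_nT^n\in VH_T$; it has two commuting actions of $VH_T$: $P_2(Q_2\delta)=(PQ)_2\delta$ and $P_1(Q_2\delta)=(QP^* )_2\delta$ (so $P_1\delta=P_2^*\delta$). The module $V(\tau_1,\tau_2,\tau_3)$ of three-variable fields consists of finite sums $\sum_{n,p}v_{n,p}(\tau_3)T_1^{-n}T_2^{-p}\delta(\tau_1,\tau_2,\tau_3)$ with unique $v_{n,p}\in V$. A bilinear bracket $\{f(\tau_1),g(\tau_2)\}=\Gamma(f)(g)=\sum_n (f_ng)(\tau_2)T_2^n\delta(\tau_1,\tau_2)\in V(\tau_1,\tau_2)$, $f,g\in V$ (which defines the products $f_ng\in V$), is a singular Hamiltonian map if for all $f,g,k\in V$, $h\in H_T$: (1) $\Gamma(f)(gk)=g_2\Gamma(f)(k)+k_2\Gamma(f)(g)$ and $\Gamma(f)(hg)=h_2\Gamma(f)(g)$; and $\Gamma(fk)(g)=f_1\Gamma(k)(g)+k_1\Gamma(f)(g)$, $\Gamma(hf)(g)=h_1\Gamma(f)(g)$; (2) $\{f(\tau_1),g(\tau_2)\}=-\{g(\tau_2),f(\tau_1)\}$,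 where $\{g(\tau_2),f(\tau_1)\}=\big(\sum_n(g_nf)T^n\big)_1\delta(\tau_1,\tau_2)$; (3) $\{f(\tau_1),\{g(\tau_2),k(\tau_3)\}\}=\{\{f(\tau_1),g(\tau_2)\},k(\tau_3)\}+\{g(\tau_2),\{f(\tau_1),k(\tau_3)\}\}$ in $V(\tau_1,\tau_2,\tau_3)$, where $\{f(\tau_1),\{g(\tau_2),k(\tau_3)\}\}=\sum_{n,p}f_n(g_pk)(\tau_3)T_1^{-n}T_2^{-p}\delta(\tau_1,\tau_2,\tau_3)$, $\{g(\tau_2),\{f(\tau_1),k(\tau_3)\}\}=\sum_{n,p}g_p(f_nk)(\tau_3)T_1^{-n}T_2^{-p}\delta(\tau_1,\tau_2,\tau_3)$, $\{\{f(\tau_1),g(\tau_2)\},k(\tau_3)\}=\sum_{q,r}((f_qg)_rk)(\tau_3)T_1^{-q-r}T_2^{-r}\delta(\tau_1,\tau_2,\tau_3)$. An $H_T$-conformal algebra is an $H_T$-module $C$ with bilinear operations $(f,g)\mapsto f_ng$, $n\in\mathbb Z$, such that for all $f,g\in C$ and $m,n,p\in\mathbb Z$: $f_ng=0$ for all but finitely many $n$; $(T^pf)_n=f_{n+p}$; $f_ng=-T^n\langle g_{-n}f\rangle$; $[f_m,g_n]=(f_{m-n}g)_n$ (commutator of linear operators on $C$). An $H_T$-vertex Poisson algebra is a commutative $H_T$-Leibniz algebra $V$ that is also an $H_T$-conformal algebra (for the same $H_T$-module structure) such that each $f_n\colon V\to V$ is a derivation of the algebra $V$. *)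

theory Defs
  imports Complex_Main "HOL-Library.Poly_Mapping"
begin

section \<open>$H_T$-modules and commutative $H_T$-Leibniz algebras\<close>

text \<open>The ring structure of \<open>HT\<close> is the convolution product of \<^theory>\<open>HOL-Library.Poly_Mapping\<close>,
  so \<open>HT\<close> is the ring of Laurent polynomials in \<open>T = HT_T 1\<close>.\<close>

type_synonym HT = "int \<Rightarrow>\<^sub>0 complex"

definition HT_const :: "complex \<Rightarrow> HT" where
  "HT_const c = Poly_Mapping.single 0 c"

definition HT_T :: "int \<Rightarrow> HT" where
  "HT_T n = Poly_Mapping.single n 1"

locale HT_module = module act
  for act :: "HT \<Rightarrow> 'v::ab_group_add \<Rightarrow> 'v"

definition scal :: "(HT \<Rightarrow> 'v \<Rightarrow> 'v) \<Rightarrow> complex \<Rightarrow> 'v \<Rightarrow> 'v" where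
  "scal act c = act (HT_const c)"

text \<open>Bijectivity of the action of \<open>T\<close> is automatic, since \<open>T\<close> is a unit of \<open>HT\<close>.\<close>

locale HT_Leibniz = HT_module act
  for act :: "HT \<Rightarrow> 'v::comm_ring_1 \<Rightarrow> 'v" +
  assumes scal_mult: "scal act c (x * y) = scal act c x * y"
    and T_mult: "act (HT_T 1) (x * y) = act (HT_T 1) x * act (HT_T 1) y"
    and T_one: "act (HT_T 1) 1 = 1"


section \<open>Difference operators and two-variable classical fields\<close>

text \<open>\<open>P :: 'v dop\<close> stands for $\sum_n p_n T^n$ with \<open>p\<^sub>n = lookup P n\<close>. The product of
  difference operators is the twisted product \<open>dop_mult\<close>, not the multiplication
  which \<^theory>\<open>HOL-Library.Poly_Mapping\<close> provides on this type.\<close>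

type_synonym 'v dop = "int \<Rightarrow>\<^sub>0 'v"

definition dop_mult :: "(HT \<Rightarrow> 'v \<Rightarrow> 'v) \<Rightarrow> 'v::comm_ring_1 dop \<Rightarrow> 'v dop \<Rightarrow> 'v dop" where
  "dop_mult act P Q =
     (\<Sum>m\<in>Poly_Mapping.keys P. \<Sum>n\<in>Poly_Mapping.keys Q.
        Poly_Mapping.single (m + n) (Poly_Mapping.lookup P m * act (HT_T m) (Poly_Mapping.lookup Q n)))"

definition dop_of :: "'v::comm_ring_1 \<Rightarrow> 'v dop" where
  "dop_of p = Poly_Mapping.single 0 p"

definition dop_T :: "int \<Rightarrow> 'v::comm_ring_1 dop" where
  "dop_T n = Poly_Mapping.single n 1"

definition dop_of_HT :: "(HT \<Rightarrow> 'v \<Rightarrow> 'v) \<Rightarrow> HT \<Rightarrow> 'v::comm_ring_1 dop" where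
  "dop_of_HT act h = (\<Sum>n\<in>Poly_Mapping.keys h. Poly_Mapping.single n (scal act (Poly_Mapping.lookup h n) 1))"

definition dop_adjoint :: "(HT \<Rightarrow> 'v \<Rightarrow> 'v) \<Rightarrow> 'v::comm_ring_1 dop \<Rightarrow> 'v dop" where
  "dop_adjoint act P =
     (\<Sum>n\<in>Poly_Mapping.keys P. Poly_Mapping.single (- n) (act (HT_T (- n)) (Poly_Mapping.lookup P n)))"

text \<open>The field $Q_2\delta(\tau_1,\tau_2)$ is represented by its unique operator \<open>Q\<close>, with
  coefficients taken at $\tau_2$.\<close>

type_synonym 'v field2 = "'v dop"

definition delta2 :: "'v::comm_ring_1 field2" where
  "delta2 = Poly_Mapping.single 0 1"

definition act_2 :: "(HT \<Rightarrow> 'v \<Rightarrow> 'v) \<Rightarrow> 'v::comm_ring_1 dop \<Rightarrow> 'v field2 \<Rightarrow> 'v field2" where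
  "act_2 act P Q = dop_mult act P Q"

definition act_1 :: "(HT \<Rightarrow> 'v \<Rightarrow> 'v) \<Rightarrow> 'v::comm_ring_1 dop \<Rightarrow> 'v field2 \<Rightarrow> 'v field2" where
  "act_1 act P Q = dop_mult act Q (dop_adjoint act P)"

definition scal_field2 :: "(HT \<Rightarrow> 'v \<Rightarrow> 'v) \<Rightarrow> complex \<Rightarrow> 'v::comm_ring_1 field2 \<Rightarrow> 'v field2" where
  "scal_field2 act c Q = Poly_Mapping.map (scal act c) Q"


section \<open>Singular Hamiltonian maps\<close>

definition products :: "('v \<Rightarrow> 'v \<Rightarrow> 'v::comm_ring_1 field2) \<Rightarrow> int \<Rightarrow> 'v \<Rightarrow> 'v \<Rightarrow> 'v" where
  "products \<Gamma> n f g = Poly_Mapping.lookup (\<Gamma> f g) n"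

text \<open>The coefficient at \<open>(a, b)\<close> is that of $T_1^a T_2^b\delta(\tau_1,\tau_2,\tau_3)$, taken at
  $\tau_3$.\<close>

type_synonym 'v field3 = "int \<times> int \<Rightarrow>\<^sub>0 'v"

text \<open>\<open>bracket_1_23 \<Gamma> f g k\<close> is $\{f(\tau_1),\{g(\tau_2),k(\tau_3)\}\}$, \<open>bracket_2_13 \<Gamma> f g k\<close> is
  $\{g(\tau_2),\{f(\tau_1),k(\tau_3)\}\}$ and \<open>bracket_12_3 \<Gamma> f g k\<close> is
  $\{\{f(\tau_1),g(\tau_2)\},k(\tau_3)\}$.\<close>

definition bracket_1_23 ::
  "('v \<Rightarrow> 'v \<Rightarrow> 'v::comm_ring_1 field2) \<Rightarrow> 'v \<Rightarrow> 'v \<Rightarrow> 'v \<Rightarrow> 'v field3" where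
  "bracket_1_23 \<Gamma> f g k =
     (\<Sum>p\<in>Poly_Mapping.keys (\<Gamma> g k). \<Sum>n\<in>Poly_Mapping.keys (\<Gamma> f (products \<Gamma> p g k)).
        Poly_Mapping.single (- n, - p) (products \<Gamma> n f (products \<Gamma> p g k)))"

definition bracket_2_13 ::
  "('v \<Rightarrow> 'v \<Rightarrow> 'v::comm_ring_1 field2) \<Rightarrow> 'v \<Rightarrow> 'v \<Rightarrow> 'v \<Rightarrow> 'v field3" where
  "bracket_2_13 \<Gamma> f g k =
     (\<Sum>n\<in>Poly_Mapping.keys (\<Gamma> f k). \<Sum>p\<in>Poly_Mapping.keys (\<Gamma> g (products \<Gamma> n f k)).
        Poly_Mapping.single (- n, - p) (products \<Gamma> p g (products \<Gamma> n f k)))"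

definition bracket_12_3 ::
  "('v \<Rightarrow> 'v \<Rightarrow> 'v::comm_ring_1 field2) \<Rightarrow> 'v \<Rightarrow> 'v \<Rightarrow> 'v \<Rightarrow> 'v field3" where
  "bracket_12_3 \<Gamma> f g k =
     (\<Sum>q\<in>Poly_Mapping.keys (\<Gamma> f g). \<Sum>r\<in>Poly_Mapping.keys (\<Gamma> (products \<Gamma> q f g) k).
        Poly_Mapping.single (- q - r, - r) (products \<Gamma> r (products \<Gamma> q f g) k))"

locale singular_Hamiltonian = HT_Leibniz act
  for act :: "HT \<Rightarrow> 'v::comm_ring_1 \<Rightarrow> 'v" +
  fixes \<Gamma> :: "'v \<Rightarrow> 'v \<Rightarrow> 'v field2"
  assumes linear_right: "Vector_Spaces.linear (scal act) (scal_field2 act) (\<Gamma> f)"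
    and linear_left: "Vector_Spaces.linear (scal act) (scal_field2 act) (\<lambda>f. \<Gamma> f g)"
    and Leibniz_right:
      "\<Gamma> f (g * k) = act_2 act (dop_of g) (\<Gamma> f k) + act_2 act (dop_of k) (\<Gamma> f g)"
    and HT_right: "\<Gamma> f (act h g) = act_2 act (dop_of_HT act h) (\<Gamma> f g)"
    and Leibniz_left:
      "\<Gamma> (f * k) g = act_1 act (dop_of f) (\<Gamma> k g) + act_1 act (dop_of k) (\<Gamma> f g)"
    and HT_left: "\<Gamma> (act h f) g = act_1 act (dop_of_HT act h) (\<Gamma> f g)"
    and skew: "\<Gamma> f g = - act_1 act (\<Gamma> g f) delta2"
    and Jacobi: "bracket_1_23 \<Gamma> f g k = bracket_12_3 \<Gamma> f g k + bracket_2_13 \<Gamma> f g k"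


section \<open>$H_T$-conformal and $H_T$-vertex Poisson algebras\<close>

locale HT_conformal = HT_module act
  for act :: "HT \<Rightarrow> 'v::ab_group_add \<Rightarrow> 'v" +
  fixes pr :: "int \<Rightarrow> 'v \<Rightarrow> 'v \<Rightarrow> 'v"
  assumes pr_linear_right: "Vector_Spaces.linear (scal act) (scal act) (pr n f)"
    and pr_linear_left: "Vector_Spaces.linear (scal act) (scal act) (\<lambda>f. pr n f g)"
    and pr_finite: "finite {n. pr n f g \<noteq> 0}"
    and pr_T: "pr n (act (HT_T p) f) g = pr (n + p) f g"
    and pr_skew: "pr n f g = - act (HT_T n) (pr (- n) g f)"
    and pr_commutator:
      "pr m f (pr n g k) - pr n g (pr m f k) = pr n (pr (m - n) f g) k"

locale HT_vertex_Poisson = HT_Leibniz act + HT_conformal act pr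
  for act :: "HT \<Rightarrow> 'v::comm_ring_1 \<Rightarrow> 'v" and pr :: "int \<Rightarrow> 'v \<Rightarrow> 'v \<Rightarrow> 'v" +
  assumes pr_derivation: "pr n f (g * k) = pr n f g * k + g * pr n f k"


section \<open>Free difference algebras\<close>

text \<open>Polynomials over the complex numbers in the variables \<open>(Y, n)\<close>, where \<open>(Y, n)\<close> stands for
  $T^nY$; keys are monomials, given by their exponents.\<close>

type_synonym 'g free_diff = "('g \<times> int \<Rightarrow>\<^sub>0 nat) \<Rightarrow>\<^sub>0 complex"

definition fd_const :: "complex \<Rightarrow> 'g free_diff" where
  "fd_const c = Poly_Mapping.single 0 c"

definition fd_var :: "'g \<Rightarrow> int \<Rightarrow> 'g free_diff" where
  "fd_var Y n = Poly_Mapping.single (Poly_Mapping.single (Y, n) 1) 1"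

text \<open>The substitution $T^iY \mapsto T^{i+n}Y$.\<close>

definition fd_shift :: "int \<Rightarrow> 'g free_diff \<Rightarrow> 'g free_diff" where
  "fd_shift n p =
     (\<Sum>m\<in>Poly_Mapping.keys p. fd_const (Poly_Mapping.lookup p m) *
        (\<Prod>(Y, i)\<in>Poly_Mapping.keys m. fd_var Y (i + n) ^ Poly_Mapping.lookup m (Y, i)))"

definition fd_act :: "HT \<Rightarrow> 'g free_diff \<Rightarrow> 'g free_diff" where
  "fd_act h p = (\<Sum>n\<in>Poly_Mapping.keys h. fd_const (Poly_Mapping.lookup h n) * fd_shift n p)"

datatype gen = Gen_A | Gen_B | Gen_C

abbreviation gvar :: "gen \<Rightarrow> gen free_diff" where
  "gvar Y \<equiv> fd_var Y 0"

text \<open>$\{B(\tau_1),C(\tau_2)\}=C(\tau_2)(T_2^{-1}-1)\delta(\tau_1,\tau_2)$,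
  $\{C(\tau_1),B(\tau_2)\}=(1-T_2)C(\tau_2)\delta(\tau_1,\tau_2)$; in the latter $T_2$ also acts on
  the coefficient $C(\tau_2)$.\<close>

definition generator_brackets ::
  "(gen free_diff \<Rightarrow> gen free_diff \<Rightarrow> gen free_diff field2) \<Rightarrow> bool" where
  "generator_brackets \<Gamma> \<longleftrightarrow>
     \<Gamma> (gvar Gen_B) (gvar Gen_C) =
       act_2 fd_act (dop_of (gvar Gen_C)) (act_2 fd_act (dop_T (- 1) - dop_T 0) delta2) \<and>
     \<Gamma> (gvar Gen_C) (gvar Gen_B) =
       act_2 fd_act (dop_T 0 - dop_T 1) (act_2 fd_act (dop_of (gvar Gen_C)) delta2) \<and>
     (\<forall>Y Z. (Y, Z) \<noteq> (Gen_B, Gen_C) \<and> (Y, Z) \<noteq> (Gen_C, Gen_B) \<longrightarrow>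
        \<Gamma> (gvar Y) (gvar Z) = 0)"

end

theory Submission
  imports Defs
begin

text \<open>
  The conformal identities force $f_n g = (T^n f)_0 g$, and the product $\{f, g\} = f_0 g$ is then
  an ordinary Poisson bracket on $V$ which commutes with $T$ and is local: $\{T^n f, g\} = 0$ for
  almost all $n$. Conversely every local $T$-invariant Poisson bracket gives a singular Hamiltonian
  map with $f_n g = \{T^n f, g\}$. On a polynomial algebra such a bracket is determined by its values
  on the variables as a biderivation, and skew symmetry, invariance, locality and the Jacobi identity
  need only be checked there. In the case at hand the variables span a Lie algebra in which the
  $T^i B$ act diagonally on the span of the $T^j C$ and all other brackets vanish.
\<close>

section \<open>Polynomials\<close>

lemma fd_const_0 [simp]: "fd_const 0 = 0"
  and fd_const_1 [simp]: "fd_const 1 = 1"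
  by (simp_all add: fd_const_def)

lemma fd_const_add: "fd_const (a + b) = fd_const a + fd_const b"
  by (simp add: fd_const_def single_add)

lemma fd_const_uminus: "fd_const (- a) = - fd_const a"
  by (simp add: fd_const_def single_uminus)

lemma fd_const_mult: "fd_const (a * b) = fd_const a * fd_const b"
  by (simp add: fd_const_def mult_single)

definition monom :: "('g \<times> int \<Rightarrow>\<^sub>0 nat) \<Rightarrow> 'g free_diff" where
  "monom m = Poly_Mapping.single m 1"

lemma monom_0 [simp]: "monom 0 = 1"
  by (simp add: monom_def)

lemma monom_add: "monom (m + n) = monom m * monom n"
  by (simp add: monom_def mult_single)

lemma const_mult_monom: "fd_const c * monom m = Poly_Mapping.single m c"
  by (simp add: fd_const_def monom_def mult_single)

lemma fd_var_eq_monom: "fd_var Y i = monom (Poly_Mapping.single (Y, i) 1)"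
  by (simp add: fd_var_def monom_def)

text \<open>Linear extension of a map from a basis. The index type is left open because two bases
  occur: the monomials of V, for shifts and derivations, and the powers of T, for the action of
  \<open>HT\<close>.\<close>

definition lin_ext :: "('a \<Rightarrow> 'g free_diff) \<Rightarrow> ('a \<Rightarrow>\<^sub>0 complex) \<Rightarrow> 'g free_diff" where
  "lin_ext e p = (\<Sum>m\<in>Poly_Mapping.keys p. fd_const (Poly_Mapping.lookup p m) * e m)"

text \<open>Cancellation can make the support of \<open>p + q\<close> smaller than the union of the
  two supports. Additivity therefore compares sums over a common finite set, where the extra terms
  vanish.\<close>

lemma lin_ext_superset:
  assumes "finite K" "Poly_Mapping.keys p \<subseteq> K"
  shows "lin_ext e p = (\<Sum>m\<in>K. fd_const (Poly_Mapping.lookup p m) * e m)"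
  unfolding lin_ext_def
  by (rule sum.mono_neutral_left) (use assms in \<open>auto simp: in_keys_iff\<close>)

lemma lin_ext_0 [simp]: "lin_ext e 0 = 0"
  by (simp add: lin_ext_def)

lemma lin_ext_single: "lin_ext e (Poly_Mapping.single m c) = fd_const c * e m"
  by (simp add: lin_ext_def)

lemma lin_ext_monom [simp]: "lin_ext e (monom m) = e m"
  by (simp add: monom_def lin_ext_single)

lemma lin_ext_add: "lin_ext e (p + q) = lin_ext e p + lin_ext e q"
proof -
  let ?K = "Poly_Mapping.keys p \<union> Poly_Mapping.keys q"
  have "lin_ext e (p + q) = (\<Sum>m\<in>?K. fd_const (Poly_Mapping.lookup (p + q) m) * e m)"
    using keys_add[of p q] by (intro lin_ext_superset) auto
  also have "\<dots> = (\<Sum>m\<in>?K. fd_const (Poly_Mapping.lookup p m) * e m)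
      + (\<Sum>m\<in>?K. fd_const (Poly_Mapping.lookup q m) * e m)"
    by (simp add: lookup_add fd_const_add algebra_simps sum.distrib)
  also have "\<dots> = lin_ext e p + lin_ext e q"
    by (subst (1 2) lin_ext_superset[of ?K]) auto
  finally show ?thesis .
qed

lemma poly_mapping_single_induct [case_names zero single add]:
  fixes p :: "'a \<Rightarrow>\<^sub>0 'b::comm_monoid_add"
  assumes "P 0"
    and single: "\<And>c m. P (Poly_Mapping.single m c)"
    and add: "\<And>p q. P p \<Longrightarrow> P q \<Longrightarrow> P (p + q)"
  shows "P p"
proof (induction p rule: update_induct)
  case const
  show ?case by fact
next
  case (update p m c)
  have "Poly_Mapping.update m c p = p + Poly_Mapping.single m c"
    using update(1)
    by (intro poly_mapping_eqI)
      (auto simp: lookup_update lookup_add lookup_single in_keys_iff when_def)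
  then show ?case using add[OF update(3) single] by simp
qed

text \<open>V is generated as an algebra by constants and variables. Hence an identity whose two
  sides behave alike under sums and products needs checking on variables only; the facts about
  shifts and brackets below rest on this.\<close>

lemma free_diff_induct [case_names const var add mult]:
  fixes p :: "'g free_diff"
  assumes const: "\<And>c. P (fd_const c)"
    and var: "\<And>Y i. P (fd_var Y i)"
    and add: "\<And>p q. P p \<Longrightarrow> P q \<Longrightarrow> P (p + q)"
    and mult: "\<And>p q. P p \<Longrightarrow> P q \<Longrightarrow> P (p * q)"
  shows "P p"
proof -
  have one: "P 1"
    using const[of 1] by simp
  have pow: "P (monom (Poly_Mapping.single u k))" for u :: "'g \<times> int" and k :: nat
  proof (induction k)
    case 0
    show ?case using one by simp
  next
    case (Suc k)
    have "monom (Poly_Mapping.single u (Suc k))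
        = fd_var (fst u) (snd u) * monom (Poly_Mapping.single u k)"
      by (simp add: fd_var_eq_monom flip: monom_add single_add)
    then show ?case using mult[OF var Suc] by simp
  qed
  have mon: "P (monom m)" for m :: "'g \<times> int \<Rightarrow>\<^sub>0 nat"
  proof (induction m rule: update_induct)
    case const
    show ?case using one by simp
  next
    case (update m u k)
    have "Poly_Mapping.update u k m = m + Poly_Mapping.single u k"
      using update(1)
      by (intro poly_mapping_eqI)
        (auto simp: lookup_update lookup_add lookup_single in_keys_iff when_def)
    then show ?case using mult[OF update(3) pow] by (simp add: monom_add)
  qed
  show ?thesis
  proof (induction p rule: poly_mapping_single_induct)
    case zero
    show ?case using const[of 0] by simp
  next
    case (single c m)
    show ?case using mult[OF const mon] by (simp add: const_mult_monom)
  next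
    case (add p q)
    then show ?case by (rule assms(3))
  qed
qed

lemma lin_ext_const_mult: "lin_ext e (fd_const c * p) = fd_const c * lin_ext e p"
proof (induction p rule: poly_mapping_single_induct)
  case (single d m)
  have "fd_const c * Poly_Mapping.single m d = Poly_Mapping.single m (c * d)"
    by (simp add: fd_const_def mult_single)
  then show ?case by (simp add: lin_ext_single fd_const_mult mult.assoc)
qed (simp_all add: lin_ext_add distrib_left)


section \<open>The shift automorphisms\<close>

definition monom_shift :: "int \<Rightarrow> ('g \<times> int \<Rightarrow>\<^sub>0 nat) \<Rightarrow> 'g free_diff" where
  "monom_shift n m = (\<Prod>(Y, i)\<in>Poly_Mapping.keys m. fd_var Y (i + n) ^ Poly_Mapping.lookup m (Y, i))"

lemma fd_shift_eq_lin_ext: "fd_shift n = lin_ext (monom_shift n)"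
  by (simp add: fun_eq_iff fd_shift_def lin_ext_def monom_shift_def)

lemma monom_shift_superset:
  assumes "finite K" "Poly_Mapping.keys m \<subseteq> K"
  shows "monom_shift n m = (\<Prod>(Y, i)\<in>K. fd_var Y (i + n) ^ Poly_Mapping.lookup m (Y, i))"
  unfolding monom_shift_def
  by (rule prod.mono_neutral_left) (use assms in \<open>auto simp: in_keys_iff\<close>)

lemma monom_shift_add: "monom_shift n (l + m) = monom_shift n l * monom_shift n m"
proof -
  let ?K = "Poly_Mapping.keys l \<union> Poly_Mapping.keys m"
  have "monom_shift n (l + m) =
      (\<Prod>(Y, i)\<in>?K. fd_var Y (i + n) ^ Poly_Mapping.lookup (l + m) (Y, i))"
    using keys_add[of l m] by (intro monom_shift_superset) auto
  also have "\<dots> = (\<Prod>(Y, i)\<in>?K. fd_var Y (i + n) ^ Poly_Mapping.lookup l (Y, i))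
      * (\<Prod>(Y, i)\<in>?K. fd_var Y (i + n) ^ Poly_Mapping.lookup m (Y, i))"
    by (simp add: lookup_add power_add prod.distrib case_prod_beta)
  also have "\<dots> = monom_shift n l * monom_shift n m"
    by (subst (1 2) monom_shift_superset[of ?K]) auto
  finally show ?thesis .
qed

lemma fd_shift_0 [simp]: "fd_shift n 0 = 0"
  by (simp add: fd_shift_eq_lin_ext)

lemma fd_shift_add: "fd_shift n (p + q) = fd_shift n p + fd_shift n q"
  by (simp add: fd_shift_eq_lin_ext lin_ext_add)

lemma fd_shift_const [simp]: "fd_shift n (fd_const c) = fd_const c"
  by (simp add: fd_shift_eq_lin_ext fd_const_def[of c] lin_ext_single)
    (simp add: fd_const_def monom_shift_def)

lemma fd_shift_1 [simp]: "fd_shift n 1 = 1"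
  using fd_shift_const[of n 1] by simp

lemma fd_shift_var [simp]: "fd_shift n (fd_var Y i) = fd_var Y (i + n)"
  by (simp add: fd_shift_eq_lin_ext fd_var_eq_monom[of Y i]) (simp add: monom_shift_def)

text \<open>Both sides are biadditive in p and q, so scalar multiples of monomials suffice, and
  there exponents add.\<close>

lemma fd_shift_mult: "fd_shift n (p * q) = fd_shift n p * fd_shift n q"
proof (induction p rule: poly_mapping_single_induct)
  case (single c l)
  show ?case
  proof (induction q rule: poly_mapping_single_induct)
    case (single d m)
    show ?case
      by (simp add: fd_shift_eq_lin_ext mult_single lin_ext_single monom_shift_add
          fd_const_mult algebra_simps)
  qed (simp_all add: fd_shift_add distrib_left)
qed (simp_all add: fd_shift_add distrib_right)

lemma fd_shift_zero_shift [simp]: "fd_shift 0 p = p"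
  by (induction p rule: free_diff_induct) (simp_all add: fd_shift_add fd_shift_mult)

lemma fd_shift_shift: "fd_shift m (fd_shift n p) = fd_shift (m + n) p"
  by (induction p rule: free_diff_induct) (simp_all add: fd_shift_add fd_shift_mult algebra_simps)

lemma fd_shift_sum: "fd_shift n (sum f A) = (\<Sum>x\<in>A. fd_shift n (f x))"
  by (induction A rule: infinite_finite_induct) (simp_all add: fd_shift_add)


section \<open>Derivations\<close>

text \<open>The derivation with values h on the variables, applied to a monomial: the partial
  derivative in u is weighted by h u. Subtraction of exponents is truncated, but it is applied only
  to variables u that occur in m.\<close>

definition monom_deriv :: "('g \<times> int \<Rightarrow> 'g free_diff) \<Rightarrow> ('g \<times> int \<Rightarrow>\<^sub>0 nat) \<Rightarrow> 'g free_diff" where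
  "monom_deriv h m = (\<Sum>u\<in>Poly_Mapping.keys m.
     of_nat (Poly_Mapping.lookup m u) * monom (m - Poly_Mapping.single u 1) * h u)"

definition fd_deriv :: "('g \<times> int \<Rightarrow> 'g free_diff) \<Rightarrow> 'g free_diff \<Rightarrow> 'g free_diff" where
  "fd_deriv h = lin_ext (monom_deriv h)"

lemma monom_deriv_superset:
  assumes "finite K" "Poly_Mapping.keys m \<subseteq> K"
  shows "monom_deriv h m = (\<Sum>u\<in>K.
     of_nat (Poly_Mapping.lookup m u) * monom (m - Poly_Mapping.single u 1) * h u)"
  unfolding monom_deriv_def
  by (rule sum.mono_neutral_left) (use assms in \<open>auto simp: in_keys_iff\<close>)

lemma monom_deriv_add:
  "monom_deriv h (l + m) = monom_deriv h l * monom m + monom l * monom_deriv h m"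
proof -
  let ?K = "Poly_Mapping.keys l \<union> Poly_Mapping.keys m"
  let ?t = "\<lambda>m u. of_nat (Poly_Mapping.lookup m u) * monom (m - Poly_Mapping.single u 1)"
  \<comment> \<open>This is the derivative falling on the left factor. If u does not occur in l, the
    truncated differences may disagree, but the multiplicity 0 kills both sides. Keeping l and m
    general gives the right factor by exchanging them.\<close>
  have lower: "of_nat (Poly_Mapping.lookup l u) * monom (l + m - Poly_Mapping.single u 1)
      = ?t l u * monom m" for l m :: "'a \<times> int \<Rightarrow>\<^sub>0 nat" and u
  proof (cases "Poly_Mapping.lookup l u = 0")
    case False
    then have "l + m - Poly_Mapping.single u 1 = (l - Poly_Mapping.single u 1) + m"
      by (intro poly_mapping_eqI) (auto simp: lookup_add lookup_minus lookup_single when_def)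
    then show ?thesis by (simp add: monom_add mult.assoc)
  qed simp
  have summand: "?t (l + m) u * h u = ?t l u * h u * monom m + monom l * (?t m u * h u)" for u
    using lower[of l u m] lower[of m u l]
    by (simp add: lookup_add distrib_right add.commute[of m l] algebra_simps)
  have "monom_deriv h (l + m) = (\<Sum>u\<in>?K. ?t (l + m) u * h u)"
    using keys_add[of l m] by (intro monom_deriv_superset) auto
  also have "\<dots> = (\<Sum>u\<in>?K. ?t l u * h u) * monom m + monom l * (\<Sum>u\<in>?K. ?t m u * h u)"
    unfolding summand by (simp add: sum.distrib sum_distrib_left sum_distrib_right)
  also have "\<dots> = monom_deriv h l * monom m + monom l * monom_deriv h m"
    by (subst (1 2) monom_deriv_superset[of ?K]) auto
  finally show ?thesis .
qed

lemma fd_deriv_0 [simp]: "fd_deriv h 0 = 0"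
  by (simp add: fd_deriv_def)

lemma fd_deriv_add: "fd_deriv h (p + q) = fd_deriv h p + fd_deriv h q"
  by (simp add: fd_deriv_def lin_ext_add)

lemma fd_deriv_const [simp]: "fd_deriv h (fd_const c) = 0"
  by (simp add: fd_deriv_def fd_const_def[of c] lin_ext_single monom_deriv_def)

lemma fd_deriv_var [simp]: "fd_deriv h (fd_var Y i) = h (Y, i)"
  by (simp add: fd_deriv_def fd_var_eq_monom monom_deriv_def)

lemma fd_deriv_mult: "fd_deriv h (p * q) = fd_deriv h p * q + p * fd_deriv h q"
proof (induction p rule: poly_mapping_single_induct)
  case (single c l)
  show ?case
  proof (induction q rule: poly_mapping_single_induct)
    case (single d m)
    show ?case
      by (simp add: fd_deriv_def mult_single lin_ext_single monom_deriv_add)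
        (simp add: fd_const_mult algebra_simps flip: const_mult_monom)
  qed (simp_all add: fd_deriv_add algebra_simps)
qed (simp_all add: fd_deriv_add algebra_simps)

lemma fd_deriv_0_left [simp]: "fd_deriv (\<lambda>u. 0) p = 0"
  by (induction p rule: free_diff_induct) (simp_all add: fd_deriv_add fd_deriv_mult)

text \<open>A derivation depends linearly on its values on the variables. Together with
  \<open>fd_deriv_mult_left\<close> this yields the Leibniz rule of the bracket in its second
  argument.\<close>

lemma fd_deriv_add_left: "fd_deriv (\<lambda>u. h u + k u) p = fd_deriv h p + fd_deriv k p"
  by (induction p rule: free_diff_induct) (simp_all add: fd_deriv_add fd_deriv_mult algebra_simps)

lemma fd_deriv_mult_left: "fd_deriv (\<lambda>u. q * h u) p = q * fd_deriv h p"
  by (induction p rule: free_diff_induct) (simp_all add: fd_deriv_add fd_deriv_mult algebra_simps)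


section \<open>Shift-invariant Poisson brackets\<close>

text \<open>This is the usual double sum of df/du * dg/dv * {u, v}. The inner derivation is {u, -};
  the outer one turns its values on g into {-, g}. Rules in the first argument are thus
  immediate.\<close>

definition poisson_ext ::
  "('g \<times> int \<Rightarrow> 'g \<times> int \<Rightarrow> 'g free_diff) \<Rightarrow> 'g free_diff \<Rightarrow> 'g free_diff \<Rightarrow> 'g free_diff" where
  "poisson_ext \<pi> f g = fd_deriv (\<lambda>u. fd_deriv (\<pi> u) g) f"

lemma poisson_ext_add_left: "poisson_ext \<pi> (f + f') g = poisson_ext \<pi> f g + poisson_ext \<pi> f' g"
  and poisson_ext_const_left [simp]: "poisson_ext \<pi> (fd_const c) g = 0"
  and poisson_ext_mult_left: "poisson_ext \<pi> (f * f') g = poisson_ext \<pi> f g * f' + f * poisson_ext \<pi> f' g"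
  by (simp_all add: poisson_ext_def fd_deriv_add fd_deriv_mult)

lemma poisson_ext_add_right: "poisson_ext \<pi> f (g + g') = poisson_ext \<pi> f g + poisson_ext \<pi> f g'"
  by (simp add: poisson_ext_def fd_deriv_add fd_deriv_add_left)

lemma poisson_ext_const_right [simp]: "poisson_ext \<pi> f (fd_const c) = 0"
  by (simp add: poisson_ext_def)

lemma poisson_ext_mult_right:
  "poisson_ext \<pi> f (g * g') = poisson_ext \<pi> f g * g' + g * poisson_ext \<pi> f g'"
proof -
  have "fd_deriv (\<pi> u) (g * g') = g' * fd_deriv (\<pi> u) g + g * fd_deriv (\<pi> u) g'" for u
    by (simp add: fd_deriv_mult mult.commute)
  then show ?thesis
    by (simp add: poisson_ext_def fd_deriv_add_left fd_deriv_mult_left mult.commute)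
qed

lemma poisson_ext_var [simp]: "poisson_ext \<pi> (fd_var Y i) (fd_var Z j) = \<pi> (Y, i) (Z, j)"
  by (simp add: poisson_ext_def)

lemma poisson_ext_0_left [simp]: "poisson_ext \<pi> 0 g = 0"
  by (simp add: poisson_ext_def)

lemma poisson_ext_0_right [simp]: "poisson_ext \<pi> f 0 = 0"
  by (simp add: poisson_ext_def)

lemma poisson_ext_const_mult_left:
  "poisson_ext \<pi> (fd_const c * f) g = fd_const c * poisson_ext \<pi> f g"
  by (simp add: poisson_ext_mult_left)

lemma poisson_ext_const_mult_right:
  "poisson_ext \<pi> f (fd_const c * g) = fd_const c * poisson_ext \<pi> f g"
  by (simp add: poisson_ext_mult_right)

lemma poisson_ext_sum_left: "poisson_ext \<pi> (sum F A) g = (\<Sum>x\<in>A. poisson_ext \<pi> (F x) g)"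
  by (induction A rule: infinite_finite_induct) (simp_all add: poisson_ext_add_left)

locale poisson_generators =
  fixes \<pi> :: "'g \<times> int \<Rightarrow> 'g \<times> int \<Rightarrow> 'g free_diff"
  assumes skew_gen: "\<pi> u v = - \<pi> v u"
    and shift_gen: "fd_shift n (\<pi> (Y, i) (Z, j)) = \<pi> (Y, i + n) (Z, j + n)"
    and local_gen: "finite {n. \<pi> (Y, i + n) v \<noteq> 0}"
    and Jacobi_gen: "poisson_ext \<pi> (fd_var Y i) (\<pi> (Z, j) (W, k)) =
      poisson_ext \<pi> (\<pi> (Y, i) (Z, j)) (fd_var W k) + poisson_ext \<pi> (fd_var Z j) (\<pi> (Y, i) (W, k))"
begin

abbreviation br :: "'g free_diff \<Rightarrow> 'g free_diff \<Rightarrow> 'g free_diff" where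
  "br \<equiv> poisson_ext \<pi>"

lemma br_skew: "br f g = - br g f"
proof (induction f rule: free_diff_induct)
  case (var Y i)
  show ?case
  proof (induction g rule: free_diff_induct)
    case (var Z j)
    show ?case unfolding poisson_ext_var by (rule skew_gen)
  qed (simp_all add: poisson_ext_add_left poisson_ext_add_right poisson_ext_mult_left
      poisson_ext_mult_right)
qed (simp_all add: poisson_ext_add_left poisson_ext_add_right poisson_ext_mult_left
    poisson_ext_mult_right)

lemma br_shift: "fd_shift n (br f g) = br (fd_shift n f) (fd_shift n g)"
proof (induction f rule: free_diff_induct)
  case (var Y i)
  show ?case
  proof (induction g rule: free_diff_induct)
    case (var Z j)
    show ?case by (simp add: shift_gen)
  qed (simp_all only: fd_shift_const fd_shift_add fd_shift_mult poisson_ext_add_right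
      poisson_ext_mult_right poisson_ext_const_right fd_shift_0)
qed (simp_all add: fd_shift_add fd_shift_mult poisson_ext_add_left poisson_ext_mult_left)

text \<open>For a skew biderivation the failure of the Jacobi identity is a derivation in each
  argument: the mixed products produced by the Leibniz rule cancel. Three nested inductions reduce
  the claim to variables.\<close>

lemma br_Jacobi: "br f (br g k) = br (br f g) k + br g (br f k)"
proof (induction f rule: free_diff_induct)
  case (const c)
  show ?case by simp
next
  case (var Y i)
  show ?case
  proof (induction g rule: free_diff_induct)
    case (const c)
    show ?case by simp
  next
    case (var Z j)
    show ?case
    proof (induction k rule: free_diff_induct)
      case (const c)
      show ?case by simp
    next
      case (var W l)
      show ?case unfolding poisson_ext_var by (rule Jacobi_gen)
    next
      case (add k k')
      show ?case
        unfolding poisson_ext_add_right add.IH by (simp only: add_ac)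
    next
      case (mult k k')
      show ?case
        unfolding poisson_ext_add_right poisson_ext_mult_right mult.IH by (simp only: algebra_simps)
    qed
  next
    case (add g g')
    show ?case
      unfolding poisson_ext_add_left poisson_ext_add_right add.IH by (simp only: add_ac)
  next
    case (mult g g')
    show ?case
      unfolding poisson_ext_add_left poisson_ext_add_right poisson_ext_mult_left
        poisson_ext_mult_right mult.IH by (simp only: algebra_simps)
  qed
next
  case (add f f')
  show ?case
    unfolding poisson_ext_add_left poisson_ext_add_right add.IH by (simp only: add_ac)
next
  case (mult f f')
  \<comment> \<open>In the first argument the mixed products from {{f f', g}, k} and {g, {f f', k}}
    contain brackets with f and g, or f' and g, in opposite orders, so skew symmetry is needed to
    cancel them.\<close>
  have skew: "br g f = - br f g" "br g f' = - br f' g"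
    by (rule br_skew)+
  show ?case
    unfolding poisson_ext_add_left poisson_ext_add_right poisson_ext_mult_left
      poisson_ext_mult_right mult.IH skew by (simp add: algebra_simps)
qed

lemma br_local: "finite {n. br (fd_shift n f) g \<noteq> 0}"
proof (induction f rule: free_diff_induct)
  case (var Y i)
  show ?case
  proof (induction g rule: free_diff_induct)
    case (var Z j)
    show ?case using local_gen by simp
  next
    case (add g g')
    \<comment> \<open>The support of the bracket with a sum, and by the Leibniz rule also with a
      product, lies in the union of the two supports.\<close>
    from finite_UnI[OF this] show ?case
      by (rule finite_subset[rotated]) (auto simp: poisson_ext_add_right)
  next
    case (mult g g')
    from finite_UnI[OF this] show ?case
      by (rule finite_subset[rotated]) (auto simp: poisson_ext_mult_right)
  qed simp
next
  case (add f f')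
  from finite_UnI[OF this] show ?case
    by (rule finite_subset[rotated]) (auto simp: fd_shift_add poisson_ext_add_left)
next
  case (mult f f')
  from finite_UnI[OF this] show ?case
    by (rule finite_subset[rotated]) (auto simp: fd_shift_mult poisson_ext_mult_left)
qed simp

text \<open>The coefficient of T^n is {T^n f, g}; \<open>br_local\<close> is what makes this family
  a finitely supported operator.\<close>

definition \<Gamma> :: "'g free_diff \<Rightarrow> 'g free_diff \<Rightarrow> 'g free_diff field2" where
  "\<Gamma> f g = Abs_poly_mapping (\<lambda>n. br (fd_shift n f) g)"

lemma lookup_\<Gamma>: "Poly_Mapping.lookup (\<Gamma> f g) n = br (fd_shift n f) g"
  unfolding \<Gamma>_def by (subst lookup_Abs_poly_mapping) (simp_all add: br_local)

end


section \<open>Coefficients of difference operators\<close>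

context HT_module
begin

lemma act_T_0 [simp]: "act (HT_T 0) x = x"
  by (simp add: HT_T_def)

lemma act_T_T: "act (HT_T m) (act (HT_T n) x) = act (HT_T (m + n)) x"
  by (simp add: HT_T_def mult_single)

lemma scal_zero_left [simp]: "scal act 0 x = 0"
  and scal_zero_right [simp]: "scal act c 0 = 0"
  and scal_one [simp]: "scal act 1 x = x"
  by (simp_all add: scal_def HT_const_def)

lemma act_T_scal: "act (HT_T n) (scal act c x) = scal act c (act (HT_T n) x)"
  by (simp add: scal_def mult.commute)

lemma vector_space_scal: "vector_space (scal act)"
  by unfold_locales
    (simp_all add: scal_def HT_const_def single_add mult_single scale_right_distrib scale_left_distrib)

end

lemma lookup_map_fun:
  "f 0 = 0 \<Longrightarrow> Poly_Mapping.lookup (Poly_Mapping.map f P) n = f (Poly_Mapping.lookup P n)"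
  by (simp add: map.rep_eq when_def)

text \<open>Extracts one coefficient from a sum over a support. The condition F a 0 = 0 covers the
  case that a lies outside the support.\<close>

lemma sum_keys_when_eq:
  "(\<Sum>n\<in>Poly_Mapping.keys P. F n (Poly_Mapping.lookup P n) when n = a)
    = F a (Poly_Mapping.lookup P a)"
  if "F a 0 = 0" for F :: "'a \<Rightarrow> 'b::zero \<Rightarrow> 'c::comm_monoid_add"
  using that by (simp add: when_def sum.delta in_keys_iff)

context HT_Leibniz
begin

lemma lookup_scal_field2:
  "Poly_Mapping.lookup (scal_field2 act c P) n = scal act c (Poly_Mapping.lookup P n)"
  by (simp add: scal_field2_def lookup_map_fun)

lemma vector_space_scal_field2: "vector_space (scal_field2 act)"
proof -
  interpret vs: vector_space "scal act" by (rule vector_space_scal)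
  show ?thesis
    by unfold_locales
      (auto intro!: poly_mapping_eqI simp: lookup_scal_field2 lookup_add
        vs.scale_right_distrib vs.scale_left_distrib)
qed

lemma linear_field2_iff:
  "Vector_Spaces.linear (scal act) (scal_field2 act) F \<longleftrightarrow>
     (\<forall>n. Vector_Spaces.linear (scal act) (scal act) (\<lambda>x. Poly_Mapping.lookup (F x) n))"
  by (auto simp: Vector_Spaces.linear_def module_hom_def module_hom_axioms_def
      module_iff_vector_space vector_space_scal vector_space_scal_field2 poly_mapping_eq_iff
      fun_eq_iff lookup_add lookup_scal_field2)

lemma act_T_one [simp]: "act (HT_T n) 1 = 1"
proof (induction n rule: int_induct[of _ 0])
  case (step1 i)
  then show ?case using act_T_T[of i 1 1] by (simp add: T_one)
next
  \<comment> \<open>Only T itself is assumed to fix 1. Going down, T^(i-1) applied to 1 = T 1 gives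
    T^i 1.\<close>
  case (step2 i)
  then show ?case using act_T_T[of "i - 1" 1 1] by (simp add: T_one)
qed simp

text \<open>Since p T^m q T^k = p (T^m q) T^(m+k), only k = n - m contributes to T^n. The free
  choice of K permits explicit sets for concrete operators.\<close>

lemma lookup_dop_mult_superset:
  assumes "finite K" "Poly_Mapping.keys P \<subseteq> K"
  shows "Poly_Mapping.lookup (dop_mult act P Q) n =
    (\<Sum>m\<in>K. Poly_Mapping.lookup P m * act (HT_T m) (Poly_Mapping.lookup Q (n - m)))"
proof -
  have "(\<Sum>k\<in>Poly_Mapping.keys Q. a * act (HT_T m) (Poly_Mapping.lookup Q k) when m + k = n)
      = a * act (HT_T m) (Poly_Mapping.lookup Q (n - m))" for a m
    using sum_keys_when_eq[of "\<lambda>k x. a * act (HT_T m) x" "n - m" Q]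
    by (simp add: algebra_simps)
  then have "Poly_Mapping.lookup (dop_mult act P Q) n =
      (\<Sum>m\<in>Poly_Mapping.keys P. Poly_Mapping.lookup P m * act (HT_T m) (Poly_Mapping.lookup Q (n - m)))"
    by (simp add: dop_mult_def lookup_sum lookup_single)
  also have "\<dots> = (\<Sum>m\<in>K. Poly_Mapping.lookup P m * act (HT_T m) (Poly_Mapping.lookup Q (n - m)))"
    by (rule sum.mono_neutral_left) (use assms in \<open>auto simp: in_keys_iff\<close>)
  finally show ?thesis .
qed

lemma lookup_dop_mult_of:
  "Poly_Mapping.lookup (dop_mult act (dop_of f) Q) n = f * Poly_Mapping.lookup Q n"
  by (subst lookup_dop_mult_superset[of "{0}"]) (auto simp: dop_of_def)

lemma lookup_dop_mult_T_diff:
  assumes "a \<noteq> b"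
  shows "Poly_Mapping.lookup (dop_mult act (dop_T a - dop_T b) Q) n =
    act (HT_T a) (Poly_Mapping.lookup Q (n - a)) - act (HT_T b) (Poly_Mapping.lookup Q (n - b))"
  using assms
  by (subst lookup_dop_mult_superset[of "{a, b}"])
    (auto simp: in_keys_iff lookup_minus dop_T_def lookup_single when_def split: if_splits)

lemma lookup_dop_adjoint:
  "Poly_Mapping.lookup (dop_adjoint act P) n = act (HT_T n) (Poly_Mapping.lookup P (- n))"
proof -
  have "- k = n \<longleftrightarrow> k = - n" for k
    by auto
  then show ?thesis
    using sum_keys_when_eq[of "\<lambda>k. act (HT_T (- k))" "- n" P]
    by (simp add: dop_adjoint_def lookup_sum lookup_single)
qed

lemma lookup_act_1:
  "Poly_Mapping.lookup (act_1 act R P) n =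
    (\<Sum>m\<in>Poly_Mapping.keys P. Poly_Mapping.lookup P m * act (HT_T n) (Poly_Mapping.lookup R (m - n)))"
  unfolding act_1_def
  by (subst lookup_dop_mult_superset[OF finite_keys order_refl]) (simp add: lookup_dop_adjoint act_T_T del: scale_scale)

lemma lookup_act_1_of:
  "Poly_Mapping.lookup (act_1 act (dop_of f) P) n = Poly_Mapping.lookup P n * act (HT_T n) f"
proof -
  have "Poly_Mapping.lookup P m * act (HT_T n) (Poly_Mapping.lookup (dop_of f) (m - n))
      = (Poly_Mapping.lookup P m * act (HT_T n) f when m = n)" for m
    by (auto simp: dop_of_def lookup_single when_def)
  then show ?thesis
    using sum_keys_when_eq[of "\<lambda>m x. x * act (HT_T n) f" n P] by (simp add: lookup_act_1)
qed

lemma lookup_act_1_delta2: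
  "Poly_Mapping.lookup (act_1 act R delta2) n = act (HT_T n) (Poly_Mapping.lookup R (- n))"
  by (simp add: lookup_act_1 delta2_def)

lemma lookup_dop_of_HT:
  "Poly_Mapping.lookup (dop_of_HT act h) n = scal act (Poly_Mapping.lookup h n) 1"
  using sum_keys_when_eq[of "\<lambda>k c. scal act c 1" n h]
  by (simp add: dop_of_HT_def lookup_sum lookup_single)

text \<open>At the first variable T^j acts as right multiplication by T^(-j), which moves the
  coefficient of T^(n+j) to T^n. This is the origin of the rule (T^p f)_n = f_(n+p).\<close>

lemma lookup_act_1_of_HT:
  "Poly_Mapping.lookup (act_1 act (dop_of_HT act h) P) n =
    (\<Sum>j\<in>Poly_Mapping.keys h. scal act (Poly_Mapping.lookup h j) (Poly_Mapping.lookup P (n + j)))"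
proof -
  have mult_scal_1: "x * scal act c 1 = scal act c x" for c x
    by (metis mult.commute mult_1 scal_mult)
  let ?t = "\<lambda>m. scal act (Poly_Mapping.lookup h (m - n)) (Poly_Mapping.lookup P m)"
  let ?H = "(\<lambda>j. n + j) ` Poly_Mapping.keys h"
  have "Poly_Mapping.lookup (act_1 act (dop_of_HT act h) P) n = sum ?t (Poly_Mapping.keys P)"
    by (simp add: lookup_act_1 lookup_dop_of_HT act_T_scal mult_scal_1)
  \<comment> \<open>A term vanishes outside either the support of P or the translated support of h,
    so the sum passes from one to the other through their union.\<close>
  also have "\<dots> = sum ?t (Poly_Mapping.keys P \<union> ?H)"
    by (rule sum.mono_neutral_left) (auto simp: in_keys_iff)
  also have "\<dots> = sum ?t ?H"
  proof (rule sum.mono_neutral_right)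
    show "\<forall>m \<in> (Poly_Mapping.keys P \<union> ?H) - ?H. ?t m = 0"
    proof
      fix m assume "m \<in> (Poly_Mapping.keys P \<union> ?H) - ?H"
      then have "m - n \<notin> Poly_Mapping.keys h"
        by (auto simp: image_iff)
      then show "?t m = 0" by (simp add: in_keys_iff)
    qed
  qed auto
  also have "\<dots> = (\<Sum>j\<in>Poly_Mapping.keys h. ?t (n + j))"
    by (simp add: sum.reindex)
  finally show ?thesis by simp
qed

lemma lookup_act_2_of_HT:
  "Poly_Mapping.lookup (act_2 act (dop_of_HT act h) P) n =
    (\<Sum>j\<in>Poly_Mapping.keys h.
      scal act (Poly_Mapping.lookup h j) (act (HT_T j) (Poly_Mapping.lookup P (n - j))))"
proof -
  have "Poly_Mapping.keys (dop_of_HT act h) \<subseteq> Poly_Mapping.keys h"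
    by (auto simp: in_keys_iff lookup_dop_of_HT)
  from lookup_dop_mult_superset[OF finite_keys this] show ?thesis
    by (simp add: act_2_def lookup_dop_of_HT flip: scal_mult)
qed

end


section \<open>The Jacobi identity in components\<close>

lemma lookup_bracket_1_23:
  assumes "\<Gamma> f 0 = 0"
  shows "Poly_Mapping.lookup (bracket_1_23 \<Gamma> f g k) (- a, - b) =
    products \<Gamma> a f (products \<Gamma> b g k)"
proof -
  have "(\<Sum>n\<in>Poly_Mapping.keys (\<Gamma> f x). products \<Gamma> n f x when - n = - a \<and> - p = - b)
      = (products \<Gamma> a f x when p = b)" for p x
    using sum_keys_when_eq[of "\<lambda>k x. x when p = b" a "\<Gamma> f x"]
    by (simp add: products_def when_def conj_commute in_keys_iff)
  then show ?thesis
    using sum_keys_when_eq[of "\<lambda>k. products \<Gamma> a f" b "\<Gamma> g k"] assms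
    by (simp add: bracket_1_23_def lookup_sum lookup_single products_def)
qed

lemma lookup_bracket_2_13:
  assumes "\<Gamma> g 0 = 0"
  shows "Poly_Mapping.lookup (bracket_2_13 \<Gamma> f g k) (- a, - b) =
    products \<Gamma> b g (products \<Gamma> a f k)"
proof -
  have "(\<Sum>p\<in>Poly_Mapping.keys (\<Gamma> g x). products \<Gamma> p g x when - n = - a \<and> - p = - b)
      = (products \<Gamma> b g x when n = a)" for n x
    using sum_keys_when_eq[of "\<lambda>k x. x when n = a" b "\<Gamma> g x"]
    by (simp add: products_def when_def conj_commute in_keys_iff)
  then show ?thesis
    using sum_keys_when_eq[of "\<lambda>k. products \<Gamma> b g" a "\<Gamma> f k"] assms
    by (simp add: bracket_2_13_def lookup_sum lookup_single products_def)
qed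

text \<open>Matching T_1^(-q-r) T_2^(-r) with T_1^(-a) T_2^(-b) forces r = b and q = a - b, which is
  the index shift in the commutator formula.\<close>

lemma lookup_bracket_12_3:
  assumes "\<Gamma> 0 k = 0"
  shows "Poly_Mapping.lookup (bracket_12_3 \<Gamma> f g k) (- a, - b) =
    products \<Gamma> b (products \<Gamma> (a - b) f g) k"
proof -
  have "(\<Sum>r\<in>Poly_Mapping.keys (\<Gamma> x k). products \<Gamma> r x k when - q - r = - a \<and> - r = - b)
      = (products \<Gamma> b x k when q = a - b)" for q x
  proof -
    have *: "- q - r = - a \<and> - r = - b \<longleftrightarrow> r = b \<and> q = a - b" for r
      by auto
    show ?thesis
      unfolding *
      using sum_keys_when_eq[of "\<lambda>k x. x when q = a - b" b "\<Gamma> x k"]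
      by (simp add: products_def when_def conj_commute in_keys_iff)
  qed
  then show ?thesis
    using sum_keys_when_eq[of "\<lambda>n x. products \<Gamma> b x k" "a - b" "\<Gamma> f g"] assms
    by (simp add: bracket_12_3_def lookup_sum lookup_single products_def)
qed

lemma Jacobi_iff_commutator:
  assumes "\<And>f. \<Gamma> f 0 = 0" "\<And>g. \<Gamma> 0 g = 0"
  shows "bracket_1_23 \<Gamma> f g k = bracket_12_3 \<Gamma> f g k + bracket_2_13 \<Gamma> f g k \<longleftrightarrow>
    (\<forall>a b. products \<Gamma> a f (products \<Gamma> b g k) - products \<Gamma> b g (products \<Gamma> a f k) =
      products \<Gamma> b (products \<Gamma> (a - b) f g) k)"
    (is "?P = ?Q \<longleftrightarrow> ?R")
proof -
  have "?P = ?Q \<longleftrightarrow> (\<forall>a b. Poly_Mapping.lookup ?P (a, b) = Poly_Mapping.lookup ?Q (a, b))"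
    by (auto simp: poly_mapping_eq_iff fun_eq_iff)
  \<comment> \<open>Negation is a bijection of the integers, so exponents may be taken in the form
    (-a, -b).\<close>
  also have "\<dots> \<longleftrightarrow> (\<forall>a b. Poly_Mapping.lookup ?P (- a, - b) = Poly_Mapping.lookup ?Q (- a, - b))"
    by (metis minus_minus)
  also have "\<dots> \<longleftrightarrow> ?R"
    by (simp add: lookup_add lookup_bracket_1_23 lookup_bracket_2_13 lookup_bracket_12_3 assms
        diff_eq_eq)
  finally show ?thesis .
qed


section \<open>From singular Hamiltonian maps to vertex Poisson algebras\<close>

context singular_Hamiltonian
begin

text \<open>Each remaining axiom is read off from the coefficients of one Hamiltonian axiom: the
  rule for T^p from \<open>HT_left\<close>, the commutator formula from \<open>Jacobi\<close>, the
  derivation property from \<open>Leibniz_right\<close>.\<close>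

lemma HT_vertex_Poisson_products: "HT_vertex_Poisson act (products \<Gamma>)"
proof (intro HT_vertex_Poisson.intro HT_conformal.intro HT_conformal_axioms.intro
    HT_vertex_Poisson_axioms.intro HT_Leibniz_axioms HT_module_axioms)
  fix m n p f g k
  have zero: "\<Gamma> f 0 = 0" "\<Gamma> 0 g = 0" for f g
    using module_hom.zero[OF module_hom_linearI[OF linear_right]]
      module_hom.zero[OF module_hom_linearI[OF linear_left]] by auto
  show "Vector_Spaces.linear (scal act) (scal act) (products \<Gamma> n f)"
    using linear_right[of f] by (simp add: linear_field2_iff products_def[abs_def])
  show "Vector_Spaces.linear (scal act) (scal act) (\<lambda>f. products \<Gamma> n f g)"
    using linear_left[of g] by (simp add: linear_field2_iff products_def[abs_def])
  show "finite {n. products \<Gamma> n f g \<noteq> 0}"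
    by (simp add: products_def)
  show "products \<Gamma> n (act (HT_T p) f) g = products \<Gamma> (n + p) f g"
    by (simp add: products_def HT_left lookup_act_1_of_HT) (simp add: HT_T_def)
  show "products \<Gamma> n f g = - act (HT_T n) (products \<Gamma> (- n) g f)"
    using skew[of f g] by (simp add: products_def lookup_act_1_delta2)
  show "products \<Gamma> m f (products \<Gamma> n g k) - products \<Gamma> n g (products \<Gamma> m f k) =
      products \<Gamma> n (products \<Gamma> (m - n) f g) k"
    using Jacobi[of f g k] by (subst (asm) Jacobi_iff_commutator) (simp_all add: zero)
  show "products \<Gamma> n f (g * k) = products \<Gamma> n f g * k + g * products \<Gamma> n f k"
    by (simp add: products_def Leibniz_right act_2_def lookup_add lookup_dop_mult_of mult.commute
        add.commute)
qed

end


section \<open>The free difference algebra\<close>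

lemma fd_act_eq_lin_ext: "fd_act h p = lin_ext (\<lambda>n. fd_shift n p) h"
  by (simp add: fd_act_def lin_ext_def)

lemma fd_act_single: "fd_act (Poly_Mapping.single n c) p = fd_const c * fd_shift n p"
  by (simp add: fd_act_eq_lin_ext lin_ext_single)

lemma fd_act_T [simp]: "fd_act (HT_T n) = fd_shift n"
  by (simp add: fun_eq_iff HT_T_def fd_act_single)

lemma scal_fd_act [simp]: "scal fd_act c p = fd_const c * p"
  by (simp add: scal_def HT_const_def fd_act_single)

lemma fd_act_add_left: "fd_act (h + k) p = fd_act h p + fd_act k p"
  by (simp add: fd_act_eq_lin_ext lin_ext_add)

lemma fd_act_add_right: "fd_act h (p + q) = fd_act h p + fd_act h q"
  by (simp add: fd_act_def fd_shift_add distrib_left sum.distrib)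

lemma fd_act_mult: "fd_act h (fd_act k p) = fd_act (h * k) p"
proof (induction h rule: poly_mapping_single_induct)
  case zero
  show ?case by (simp add: fd_act_def)
next
  case (single c m)
  show ?case
  proof (induction k rule: poly_mapping_single_induct)
    case zero
    show ?case by (simp add: fd_act_def)
  next
    case (single d n)
    show ?case
      by (simp add: fd_act_single mult_single fd_shift_mult fd_shift_shift fd_const_mult mult.assoc)
  qed (simp add: fd_act_add_left fd_act_add_right distrib_left)
qed (simp add: fd_act_add_left distrib_right)

interpretation fd: HT_Leibniz fd_act
proof unfold_locales
  fix h k :: HT and p q :: "'g free_diff" and c :: complex
  show "fd_act h (p + q) = fd_act h p + fd_act h q"
    by (rule fd_act_add_right)
  show "fd_act (h + k) p = fd_act h p + fd_act k p"
    by (rule fd_act_add_left)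
  show "fd_act h (fd_act k p) = fd_act (h * k) p"
    by (rule fd_act_mult)
  show "fd_act 1 p = p"
    using fd_act_T[of 0, THEN fun_cong, of p] by (simp add: HT_T_def)
  show "scal fd_act c (p * q) = scal fd_act c p * q"
    by (simp add: mult.assoc)
  show "fd_act (HT_T 1) (p * q) = fd_act (HT_T 1) p * fd_act (HT_T 1) q"
    by (simp add: fd_shift_mult)
  show "fd_act (HT_T 1) (1 :: 'g free_diff) = 1"
    by simp
qed

lemma fd_linear_iff:
  "Vector_Spaces.linear (scal fd_act) (scal fd_act) F \<longleftrightarrow>
    (\<forall>p q. F (p + q) = F p + F q) \<and> (\<forall>c p. F (fd_const c * p) = fd_const c * F p)"
  by (auto simp: Vector_Spaces.linear_def module_hom_def module_hom_axioms_def
      module_iff_vector_space fd.vector_space_scal)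

context poisson_generators
begin

lemma products_\<Gamma>: "products \<Gamma> n f g = br (fd_shift n f) g"
  by (simp add: products_def lookup_\<Gamma>)

lemma singular_Hamiltonian_\<Gamma>: "singular_Hamiltonian fd_act \<Gamma>"
proof (intro singular_Hamiltonian.intro singular_Hamiltonian_axioms.intro fd.HT_Leibniz_axioms)
  fix f g k :: "'g free_diff" and h :: HT
  show "Vector_Spaces.linear (scal fd_act) (scal_field2 fd_act) (\<Gamma> f)"
    by (simp add: fd.linear_field2_iff fd_linear_iff lookup_\<Gamma> poisson_ext_add_right
        poisson_ext_const_mult_right)
  show "Vector_Spaces.linear (scal fd_act) (scal_field2 fd_act) (\<lambda>f. \<Gamma> f g)"
    by (simp add: fd.linear_field2_iff fd_linear_iff lookup_\<Gamma> poisson_ext_add_left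
        fd_shift_add fd_shift_mult poisson_ext_const_mult_left)
  show "\<Gamma> f (g * k) = act_2 fd_act (dop_of g) (\<Gamma> f k) + act_2 fd_act (dop_of k) (\<Gamma> f g)"
    by (rule poly_mapping_eqI)
      (simp add: act_2_def lookup_add fd.lookup_dop_mult_of lookup_\<Gamma> poisson_ext_mult_right
        algebra_simps)
  show "\<Gamma> f (fd_act h g) = act_2 fd_act (dop_of_HT fd_act h) (\<Gamma> f g)"
  proof (rule poly_mapping_eqI)
    fix n
    \<comment> \<open>Linearity over sums is available on the left, so skew symmetry is applied
      before and after. The coefficients then match because {T^n f, T^j g} = T^j {T^(n-j) f,
      g}.\<close>
    have "br (fd_shift n f) (fd_act h g) =
        (\<Sum>j\<in>Poly_Mapping.keys h.
          fd_const (Poly_Mapping.lookup h j) * br (fd_shift n f) (fd_shift j g))"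
      by (subst br_skew)
        (simp add: fd_act_def poisson_ext_sum_left poisson_ext_const_mult_left
          br_skew[of "fd_shift n f"] sum_negf)
    then show "Poly_Mapping.lookup (\<Gamma> f (fd_act h g)) n =
        Poly_Mapping.lookup (act_2 fd_act (dop_of_HT fd_act h) (\<Gamma> f g)) n"
      by (simp add: lookup_\<Gamma> fd.lookup_act_2_of_HT br_shift fd_shift_shift)
  qed
  show "\<Gamma> (f * k) g = act_1 fd_act (dop_of f) (\<Gamma> k g) + act_1 fd_act (dop_of k) (\<Gamma> f g)"
    by (rule poly_mapping_eqI)
      (simp add: lookup_add fd.lookup_act_1_of lookup_\<Gamma> poisson_ext_mult_left fd_shift_mult
        algebra_simps)
  show "\<Gamma> (fd_act h f) g = act_1 fd_act (dop_of_HT fd_act h) (\<Gamma> f g)"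
    by (rule poly_mapping_eqI)
      (simp add: fd.lookup_act_1_of_HT lookup_\<Gamma> fd_act_def fd_shift_sum fd_shift_mult
        fd_shift_shift poisson_ext_sum_left poisson_ext_const_mult_left)
  show "\<Gamma> f g = - act_1 fd_act (\<Gamma> g f) delta2"
  proof (rule poly_mapping_eqI)
    fix n
    show "Poly_Mapping.lookup (\<Gamma> f g) n = Poly_Mapping.lookup (- act_1 fd_act (\<Gamma> g f) delta2) n"
      using br_skew[of "fd_shift n f" g]
      by (simp add: fd.lookup_act_1_delta2 lookup_\<Gamma> br_shift fd_shift_shift)
  qed
  have zero: "\<Gamma> f 0 = 0" "\<Gamma> 0 g = 0" for f g
    by (auto intro!: poly_mapping_eqI simp: lookup_\<Gamma>)
  \<comment> \<open>This is the Jacobi identity for T^a f, T^b g and k, with {T^a f, T^b g} = T^b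
    {T^(a-b) f, g} by invariance.\<close>
  have "br (fd_shift a f) (br (fd_shift b g) k) - br (fd_shift b g) (br (fd_shift a f) k) =
      br (fd_shift b (br (fd_shift (a - b) f) g)) k" for a b
    using br_Jacobi[of "fd_shift a f" "fd_shift b g" k] by (simp add: br_shift fd_shift_shift)
  then show "bracket_1_23 \<Gamma> f g k = bracket_12_3 \<Gamma> f g k + bracket_2_13 \<Gamma> f g k"
    by (subst Jacobi_iff_commutator) (simp_all add: zero products_\<Gamma>)
qed

end


section \<open>The bracket on the generators\<close>

text \<open>The bracket $\{T^i B, T^j C\}$ is the coefficient at $T^0$ of
  $T^j C (T^{-1} - 1) T^{-i} = (T^j C)(T^{j - 1 - i} - T^{j - i})$.\<close>

fun gen_bracket :: "gen \<times> int \<Rightarrow> gen \<times> int \<Rightarrow> gen free_diff" where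
  "gen_bracket (Gen_B, i) (Gen_C, j) = fd_const (of_bool (i + 1 = j) - of_bool (i = j)) * fd_var Gen_C j"
| "gen_bracket (Gen_C, i) (Gen_B, j) = fd_const (of_bool (j = i) - of_bool (j + 1 = i)) * fd_var Gen_C i"
| "gen_bracket u v = 0"

interpretation gen: poisson_generators gen_bracket
proof
  fix u v :: "gen \<times> int" and n i j k :: int and Y Z W :: gen
  show "gen_bracket u v = - gen_bracket v u"
    by (cases "(u, v)" rule: gen_bracket.cases) (auto simp: fd_const_uminus)
  show "fd_shift n (gen_bracket (Y, i) (Z, j)) = gen_bracket (Y, i + n) (Z, j + n)"
    by (cases Y; cases Z) (auto simp: fd_shift_mult)
  show "finite {n. gen_bracket (Y, i + n) v \<noteq> 0}"
  proof (rule finite_subset)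
    \<comment> \<open>Variables have nonzero bracket only if their shifts differ by at most
      1.\<close>
    show "{n. gen_bracket (Y, i + n) v \<noteq> 0} \<subseteq> {snd v - i - 1 .. snd v - i + 1}"
      by (cases v; cases Y; cases "fst v") (auto simp: of_bool_def split: if_splits)
  qed simp
  show "poisson_ext gen_bracket (fd_var Y i) (gen_bracket (Z, j) (W, k)) =
      poisson_ext gen_bracket (gen_bracket (Y, i) (Z, j)) (fd_var W k) +
      poisson_ext gen_bracket (fd_var Z j) (gen_bracket (Y, i) (W, k))"
    \<comment> \<open>Only triples with two B's and one C give nonzero terms, and there the scalars
      by which the B's act on T^j C commute.\<close>
    by (cases Y; cases Z; cases W)
      (auto simp: poisson_ext_const_mult_left poisson_ext_const_mult_right fd_const_uminus)
qed

lemma lookup_delta2: "Poly_Mapping.lookup delta2 n = (1 when n = 0)"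
  by (simp only: delta2_def lookup_single) (auto simp: when_def)

lemma generator_brackets_\<Gamma>: "generator_brackets gen.\<Gamma>"
  unfolding generator_brackets_def
proof (intro conjI allI impI)
  show "gen.\<Gamma> (gvar Gen_B) (gvar Gen_C) =
      act_2 fd_act (dop_of (gvar Gen_C)) (act_2 fd_act (dop_T (- 1) - dop_T 0) delta2)"
  proof (rule poly_mapping_eqI)
    fix n :: int
    show "Poly_Mapping.lookup (gen.\<Gamma> (gvar Gen_B) (gvar Gen_C)) n = Poly_Mapping.lookup
        (act_2 fd_act (dop_of (gvar Gen_C)) (act_2 fd_act (dop_T (- 1) - dop_T 0) delta2)) n"
      by (cases "n = 0"; cases "n = - 1")
        (simp_all add: gen.lookup_\<Gamma> act_2_def fd.lookup_dop_mult_of fd.lookup_dop_mult_T_diff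
          lookup_delta2 fd_const_uminus eq_neg_iff_add_eq_0)
  qed
  show "gen.\<Gamma> (gvar Gen_C) (gvar Gen_B) =
      act_2 fd_act (dop_T 0 - dop_T 1) (act_2 fd_act (dop_of (gvar Gen_C)) delta2)"
  proof (rule poly_mapping_eqI)
    fix n :: int
    show "Poly_Mapping.lookup (gen.\<Gamma> (gvar Gen_C) (gvar Gen_B)) n = Poly_Mapping.lookup
        (act_2 fd_act (dop_T 0 - dop_T 1) (act_2 fd_act (dop_of (gvar Gen_C)) delta2)) n"
      \<comment> \<open>Since T acts on the coefficient too, (1 - T) C = C - (T C) T; hence the
        coefficient at n = 1 is - T C.\<close>
      by (cases "n = 0"; cases "n = 1")
        (simp_all add: gen.lookup_\<Gamma> act_2_def fd.lookup_dop_mult_of fd.lookup_dop_mult_T_diff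
          lookup_delta2 fd_const_uminus)
  qed
next
  fix Y Z
  assume "(Y, Z) \<noteq> (Gen_B, Gen_C) \<and> (Y, Z) \<noteq> (Gen_C, Gen_B)"
  then show "gen.\<Gamma> (gvar Y) (gvar Z) = 0"
    by (cases Y; cases Z) (auto intro!: poly_mapping_eqI simp: gen.lookup_\<Gamma>)
qed

theorem mainTheorem1:
  shows "(\<exists>\<Gamma>. singular_Hamiltonian fd_act \<Gamma> \<and> generator_brackets \<Gamma>) \<and>
    (\<forall>\<Gamma>. singular_Hamiltonian fd_act \<Gamma> \<and> generator_brackets \<Gamma> \<longrightarrow>
       HT_vertex_Poisson fd_act (products \<Gamma>))"
proof (intro conjI exI allI impI)
  show "singular_Hamiltonian fd_act gen.\<Gamma>"
    by (rule gen.singular_Hamiltonian_\<Gamma>)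
  show "generator_brackets gen.\<Gamma>"
    by (rule generator_brackets_\<Gamma>)
  \<comment> \<open>The passage to vertex Poisson algebras applies to every singular Hamiltonian
    map, so no uniqueness of the extension enters.\<close>
  show "HT_vertex_Poisson fd_act (products \<Gamma>)"
    if "singular_Hamiltonian fd_act \<Gamma> \<and> generator_brackets \<Gamma>" for \<Gamma>
    using that by (intro singular_Hamiltonian.HT_vertex_Poisson_products) simp
qed

end
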